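(* For every integer $n\geq 2$, let $Q_n\subset\mathbb{R}^{n-1}$ be the $(n-1)$-dimensional lattice simplex which is the convex hull of the $n$ points $v_0=(1,1,\dots,1)$ and, for $m=1,\dots,n-1$, the point $v_m\in\mathbb{R}^{n-1}$ with coordinates $(v_m)_k=1$ for $k<m$, $(v_m)_m=-m$, and $(v_m)_k=0$ for $k>m$. Then $Q_n$ is unimodularly equivalent to its dual polytope $Q_n^\vee$.
   Context: For a polytope $\mathcal{P}\subset\mathbb{R}^d$ containing the origin in its interior, its dual polytope is $\mathcal{P}^\vee=\{y\in\mathbb{R}^d : \langle x,y\rangle\leq 1 \text{ for all } x\in\mathcal{P}\}$. Two polytopes $\mathcal{P}_1,\mathcal{P}_2\subset\mathbb{R}^d$ are unimodularly equivalent if there exist an integer matrix $U\in\mathbb{Z}^{d\times d}$ with $\det U=\pm1$ and a vector $w\in\mathbb{Z}^d$ such that $\mathcal{P}_2=\{xU : x\in\mathcal{P}_1\}+w$. Coordinates of points of $\mathbb{R}^{n-1}$ are written $(x_1,\dots,x_{n-1})$. *)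

theory Defs
  imports "HOL-Analysis.Analysis"
begin

definition dual_polytope :: "(real ^ 'd) set \<Rightarrow> (real ^ 'd) set" where
  "dual_polytope P = {y. \<forall>x\<in>P. x \<bullet> y \<le> 1}"

(* Points are row vectors, so a matrix acts from the right. *)
definition unimodularly_equivalent :: "(real ^ 'd) set \<Rightarrow> (real ^ 'd) set \<Rightarrow> bool" where
  "unimodularly_equivalent P1 P2 \<longleftrightarrow>
     (\<exists>(U :: int ^ 'd ^ 'd) (w :: int ^ 'd). (det U = 1 \<or> det U = - 1) \<and>
        P2 = (\<lambda>x. x v* map_matrix real_of_int U + (\<chi> i. real_of_int (w $ i))) ` P1)"

definition lattice_polytope :: "(real ^ 'd) set \<Rightarrow> bool" where
  "lattice_polytope P \<longleftrightarrow>
     (\<exists>V. finite V \<and> (\<forall>v\<in>V. \<forall>i. v $ i \<in> \<int>) \<and> P = convex hull V)"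

(* The index type 'd carries no order, so a bijection idx from 'd onto {1..n-1} numbers
   the coordinates: for x :: real ^ 'd, the component x $ i is the coordinate x_(idx i). *)
definition Q_vertex :: "('d \<Rightarrow> nat) \<Rightarrow> nat \<Rightarrow> real ^ 'd" where
  "Q_vertex idx m = (\<chi> i.
     if m = 0 then 1
     else if idx i < m then 1
     else if idx i = m then - real m
     else 0)"

definition Q :: "('d \<Rightarrow> nat) \<Rightarrow> nat \<Rightarrow> (real ^ 'd) set" where
  "Q idx n = convex hull (Q_vertex idx ` {0..n - 1})"

end

theory Submission
  imports Defs
begin

text \<open>Any two distinct vertices of the simplex have inner product \<open>-1\<close>. Hence the
  barycentric coordinate of a point \<open>z\<close> at the vertex \<open>v\<close> is \<open>(1 + z \<bullet> v) / (1 + v \<bullet> v)\<close>, so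
  the simplex consists of the points \<open>z\<close> with \<open>z \<bullet> v \<ge> -1\<close> for all vertices \<open>v\<close>. This set
  is the negative of the dual polytope, and the matrix \<open>-I\<close> is unimodular.\<close>

text \<open>Pairing with \<open>v\<close> sends every other vector of \<open>V\<close> to -1, so the
  coefficient at \<open>v\<close> can be read off from the combination and the total weight.\<close>

lemma sum_inner_obtuse:
  fixes V :: "'a::real_inner set"
  assumes "finite V" and obtuse: "pairwise (\<lambda>x y. x \<bullet> y = -1) V" and "v \<in> V"
  shows "(\<Sum>x\<in>V. u x *\<^sub>R x) \<bullet> v = u v * (1 + v \<bullet> v) - sum u V"
proof -
  have "(\<Sum>x\<in>V. u x *\<^sub>R x) \<bullet> v = (\<Sum>x\<in>V. u x * (x \<bullet> v))"
    by (simp add: inner_sum_left)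
  also have "\<dots> = u v * (v \<bullet> v) + (\<Sum>x\<in>V - {v}. u x * (x \<bullet> v))"
    using assms by (simp add: sum.remove)
  also have "(\<Sum>x\<in>V - {v}. u x * (x \<bullet> v)) = (\<Sum>x\<in>V - {v}. - u x)"
    using obtuse \<open>v \<in> V\<close> by (intro sum.cong) (auto simp: pairwise_def)
  also have "\<dots> = u v - sum u V"
    using assms by (simp add: sum_negf sum.remove)
  finally show ?thesis
    by (simp add: algebra_simps)
qed

lemma one_plus_inner_self_pos: "0 < 1 + v \<bullet> v"
  for v :: "'a::real_inner"
  using inner_ge_zero[of v] by linarith

text \<open>Pairing a vanishing combination of total weight 0 with \<open>v\<close> leaves
  \<open>u v * (1 + v \<bullet> v) = 0\<close>, and the second factor is positive.\<close>

lemma obtuse_affine_independent: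
  fixes V :: "'a::euclidean_space set"
  assumes "finite V" and "pairwise (\<lambda>x y. x \<bullet> y = -1) V"
  shows "\<not> affine_dependent V"
proof
  assume "affine_dependent V"
  then obtain u v where u: "sum u V = 0" "v \<in> V" "u v \<noteq> 0" "(\<Sum>x\<in>V. u x *\<^sub>R x) = 0"
    using assms(1) by (auto simp: affine_dependent_explicit_finite)
  then show False
    using sum_inner_obtuse[OF assms \<open>v \<in> V\<close>, of u] one_plus_inner_self_pos[of v] by simp
qed

text \<open>Affine independence and the cardinality make \<open>V\<close> affinely span the space,
  so weights for \<open>z\<close> exist; pairing with each \<open>v\<close> determines them.\<close>

lemma obtuse_barycentric_coordinates:
  fixes V :: "'a::euclidean_space set"
  assumes "finite V" and "pairwise (\<lambda>x y. x \<bullet> y = -1) V" and "card V = DIM('a) + 1"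
  obtains u where "sum u V = 1" "(\<Sum>x\<in>V. u x *\<^sub>R x) = z"
    "\<And>v. v \<in> V \<Longrightarrow> u v = (1 + z \<bullet> v) / (1 + v \<bullet> v)"
proof -
  have "affine hull V = UNIV"
    using obtuse_affine_independent[OF assms(1,2)] assms(3)
    by (simp add: affine_independent_span_eq)
  then obtain u where u: "sum u V = 1" "(\<Sum>x\<in>V. u x *\<^sub>R x) = z"
    using assms(1) by (auto simp: affine_hull_finite set_eq_iff)
  have "u v = (1 + z \<bullet> v) / (1 + v \<bullet> v)" if "v \<in> V" for v
    using sum_inner_obtuse[OF assms(1,2) that, of u] u one_plus_inner_self_pos[of v]
    by (simp add: field_simps)
  with u that show ?thesis
    by blast
qed

text \<open>The barycentric coordinates of the origin are \<open>1 / (1 + v \<bullet> v)\<close>,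
  and the interior of a full-dimensional simplex is where all coordinates are positive.\<close>

lemma obtuse_zero_in_interior:
  fixes V :: "'a::euclidean_space set"
  assumes "finite V" and "pairwise (\<lambda>x y. x \<bullet> y = -1) V" and "card V = DIM('a) + 1"
  shows "0 \<in> interior (convex hull V)"
proof -
  obtain u where "sum u V = 1" "(\<Sum>x\<in>V. u x *\<^sub>R x) = 0"
    and "\<And>v. v \<in> V \<Longrightarrow> u v = 1 / (1 + v \<bullet> v)"
    using obtuse_barycentric_coordinates[OF assms, of 0] by auto
  moreover from this have "\<forall>v\<in>V. 0 < u v"
    by (simp add: one_plus_inner_self_pos)
  ultimately have "0 \<in> {y. \<exists>u. (\<forall>x\<in>V. 0 < u x) \<and> sum u V = 1 \<and> (\<Sum>x\<in>V. u x *\<^sub>R x) = y}"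
    by blast
  then show ?thesis
    using obtuse_affine_independent[OF assms(1,2)] assms(3)
    by (simp add: interior_convex_hull_explicit_minimal)
qed

lemma obtuse_convex_hull_eq:
  fixes V :: "'a::euclidean_space set"
  assumes "finite V" and "pairwise (\<lambda>x y. x \<bullet> y = -1) V" and "card V = DIM('a) + 1"
  shows "convex hull V = {z. \<forall>v\<in>V. -1 \<le> v \<bullet> z}"
proof (intro equalityI subsetI CollectI ballI)
  fix z v
  assume "z \<in> convex hull V" "v \<in> V"
  \<comment> \<open>It suffices to test the vertices, since the half-space is convex. Equality holds
    at every vertex other than \<open>v\<close>.\<close>
  have "-1 \<le> v \<bullet> x" if "x \<in> V" for x
  proof (cases "x = v")
    case True
    then show ?thesis
      using one_plus_inner_self_pos[of v] by simp
  next
    case False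
    then show ?thesis
      using assms(2) that \<open>v \<in> V\<close> by (simp add: pairwise_def)
  qed
  then have "convex hull V \<subseteq> {x. -1 \<le> v \<bullet> x}"
    using convex_halfspace_ge[of "-1" v] by (intro hull_minimal) auto
  with \<open>z \<in> convex hull V\<close> show "-1 \<le> v \<bullet> z"
    by blast
next
  fix z
  assume "z \<in> {z. \<forall>v\<in>V. -1 \<le> v \<bullet> z}"
  then have z: "-1 \<le> z \<bullet> v" if "v \<in> V" for v
    using that by (simp add: inner_commute)
  obtain u where u: "sum u V = 1" "(\<Sum>x\<in>V. u x *\<^sub>R x) = z"
    and coord: "\<And>v. v \<in> V \<Longrightarrow> u v = (1 + z \<bullet> v) / (1 + v \<bullet> v)"
    using obtuse_barycentric_coordinates[OF assms] by blast
  have "0 \<le> u v" if "v \<in> V" for v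
    using coord[OF that] z[OF that] one_plus_inner_self_pos[of v] by simp
  with u show "z \<in> convex hull V"
    using assms(1) by (auto simp: convex_hull_finite)
qed

text \<open>For fixed \<open>y\<close> the inequality cuts out a convex half-space, which contains
  the hull as soon as it contains \<open>V\<close>.\<close>

lemma dual_polytope_convex_hull:
  "dual_polytope (convex hull V) = {y. \<forall>x\<in>V. x \<bullet> y \<le> 1}"
proof (intro equalityI subsetI)
  fix y
  assume "y \<in> {y. \<forall>x\<in>V. x \<bullet> y \<le> 1}"
  then have "convex hull V \<subseteq> {x. y \<bullet> x \<le> 1}"
    using convex_halfspace_le[of y 1] by (intro hull_minimal) (auto simp: inner_commute)
  then show "y \<in> dual_polytope (convex hull V)"
    by (auto simp: dual_polytope_def inner_commute)
qed (auto simp: dual_polytope_def hull_inc)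

lemma unimodularly_equivalent_uminus:
  fixes P :: "(real ^ 'd) set"
  shows "unimodularly_equivalent P (uminus ` P)"
proof -
  \<comment> \<open>The witness is the negative identity with zero translation; the sign of its
    determinant depends on the parity of the dimension.\<close>
  let ?U = "(\<chi> i j. if i = j then -1 else 0) :: int ^ 'd ^ 'd"
  have "det ?U = (\<Prod>i\<in>UNIV. ?U $ i $ i)"
    by (rule det_diagonal) simp
  then have "det ?U = (-1) ^ CARD('d)"
    by simp
  then have "det ?U = 1 \<or> det ?U = -1"
    by (simp add: power_minus1_even minus_one_power_iff)
  moreover have "x v* map_matrix real_of_int ?U + (\<chi> i. real_of_int ((0 :: int ^ 'd) $ i)) = - x"
    for x :: "real ^ 'd"
    by (simp add: vec_eq_iff vector_matrix_mult_def map_matrix_def if_distrib if_distribR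
        cong: if_cong)
  then have "uminus ` P =
      (\<lambda>x. x v* map_matrix real_of_int ?U + (\<chi> i. real_of_int ((0 :: int ^ 'd) $ i))) ` P"
    by simp
  ultimately show ?thesis
    unfolding unimodularly_equivalent_def by blast
qed

context
  fixes n :: nat and idx :: "'d::finite \<Rightarrow> nat"
  assumes idx: "bij_betw idx UNIV {1..n - 1}"
begin

lemma sum_Q_vertex:
  assumes "m \<in> {1..n - 1}"
  shows "(\<Sum>i\<in>UNIV. Q_vertex idx m $ i) = -1"
proof -
  have "(\<Sum>i\<in>UNIV. Q_vertex idx m $ i)
      = (\<Sum>k\<in>{1..n - 1}. if k < m then 1 else if k = m then - real m else 0)"
    using assms by (subst sum.reindex_bij_betw[OF idx, symmetric]) (simp add: Q_vertex_def)
  also have "\<dots> = (\<Sum>k\<in>{1..m}. if k < m then 1 else if k = m then - real m else 0)"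
    using assms by (intro sum.mono_neutral_right) auto
  also have "{1..m} = insert m {1..<m}"
    using assms by auto
  \<comment> \<open>There are \<open>m - 1\<close> ones and a single entry
    \<open>- m\<close>.\<close>
  also have "(\<Sum>k\<in>\<dots>. if k < m then 1 else if k = m then - real m else 0) = -1"
    using assms by (simp add: of_nat_diff)
  finally show ?thesis .
qed

lemma inner_Q_vertex:
  assumes "a \<le> n - 1" "b \<le> n - 1" "a \<noteq> b"
  shows "Q_vertex idx a \<bullet> Q_vertex idx b = -1"
proof -
  \<comment> \<open>Under these conditions vertex \<open>b\<close> has entry 1 wherever vertex
    \<open>a\<close> is nonzero, so the inner product is the coordinate sum of vertex
    \<open>a\<close>. Index 0 is excluded for \<open>a\<close> because the all-ones vertex has a
    different sum.\<close>
  have *: "Q_vertex idx a \<bullet> Q_vertex idx b = -1"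
    if ab: "a \<in> {1..n - 1}" "b = 0 \<or> a < b" for a b
  proof -
    have "Q_vertex idx a \<bullet> Q_vertex idx b = (\<Sum>i\<in>UNIV. Q_vertex idx a $ i)"
      unfolding inner_vec_def using ab by (intro sum.cong) (auto simp: Q_vertex_def)
    then show ?thesis
      using sum_Q_vertex[OF ab(1)] by simp
  qed
  show ?thesis
  proof (cases "b = 0 \<or> 0 < a \<and> a < b")
    case True
    then show ?thesis
      using assms by (intro *) auto
  next
    case False
    then show ?thesis
      using assms by (subst inner_commute, intro *) auto
  qed
qed

text \<open>Coinciding vertices with distinct indices would have squared norm -1.\<close>

lemma inj_on_Q_vertex: "inj_on (Q_vertex idx) {0..n - 1}"
proof (rule inj_onI, rule ccontr)
  fix a b
  assume "a \<in> {0..n - 1}" "b \<in> {0..n - 1}" "Q_vertex idx a = Q_vertex idx b" "a \<noteq> b"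
  then have "Q_vertex idx a \<bullet> Q_vertex idx a = -1"
    using inner_Q_vertex[of a b] by simp
  then show False
    using inner_ge_zero[of "Q_vertex idx a"] by linarith
qed

end

theorem theorem1:
  fixes n :: nat and idx :: "'d::finite \<Rightarrow> nat"
  assumes "n \<ge> 2"
    and "bij_betw idx UNIV {1..n - 1}"
  shows "lattice_polytope (Q idx n) \<and>
    (int n - 1) simplex (Q idx n) \<and>
    0 \<in> interior (Q idx n) \<and>
    unimodularly_equivalent (Q idx n) (dual_polytope (Q idx n))"
proof -
  define V where "V = Q_vertex idx ` {0..n - 1}"
  have Q: "Q idx n = convex hull V"
    by (simp add: Q_def V_def)
  have fin: "finite V"
    by (simp add: V_def)
  have card: "card V = n"
    using \<open>n \<ge> 2\<close> card_image[OF inj_on_Q_vertex[OF assms(2)]] by (simp add: V_def)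
  have "CARD('d) = n - 1"
    using bij_betw_same_card[OF assms(2)] by simp
  then have dim: "card V = DIM(real ^ 'd) + 1"
    using \<open>n \<ge> 2\<close> card by simp
  have obtuse: "pairwise (\<lambda>x y. x \<bullet> y = -1) V"
    unfolding V_def pairwise_def using inner_Q_vertex[OF assms(2)] by auto metis
  have "Q_vertex idx m $ i \<in> \<int>" for m i
    by (simp add: Q_vertex_def)
  then have "lattice_polytope (Q idx n)"
    unfolding lattice_polytope_def using fin by (intro exI[of _ V]) (auto simp: Q V_def)
  moreover have "(int n - 1) simplex (Q idx n)"
    unfolding simplex_def Q using obtuse_affine_independent[OF fin obtuse] card by auto
  moreover have "0 \<in> interior (Q idx n)"
    unfolding Q by (rule obtuse_zero_in_interior[OF fin obtuse dim])
  moreover have "dual_polytope (Q idx n) = uminus ` Q idx n"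
  proof -
    \<comment> \<open>Both sides say \<open>v \<bullet> y \<le> 1\<close> for every vertex
      \<open>v\<close>: the left by reduction to vertices, the right by the half-space description
      at \<open>- y\<close>.\<close>
    have "y \<in> dual_polytope (Q idx n) \<longleftrightarrow> - y \<in> Q idx n" for y
      unfolding Q dual_polytope_convex_hull
      by (simp add: obtuse_convex_hull_eq[OF fin obtuse dim])
    then show ?thesis
      by (force simp: image_iff)
  qed
  ultimately show ?thesis
    by (simp add: unimodularly_equivalent_uminus)
qed

end
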